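(* Let $I,J\subset\mathbb{R}$ be nonempty open intervals, let $f:I\to\mathbb{R}$ and $g:J\to\mathbb{R}$ be smooth, and let $M$ be the Type I translation surface in $\mathbb{R}^3$ parametrized by $\mathcal{F}(u,v)=(u,v,f(u)+g(v))$, $(u,v)\in I\times J$. Then $M$ is minimal with respect to the semi-symmetric non-metric connection $\overline\nabla$ if and only if $\mathcal{F}$ is of one of the following forms on $I\times J$: (i) $\mathcal{F}(u,v)=(u,\,v,\,c_0u+c_1v+c_2)$ for some real constants $c_0,c_1,c_2$; (ii) $\mathcal{F}(u,v)=\Big(u,\,v,\,\frac1c\ln\frac{|\cos(cu-c_3)|}{|\cos(cv-c_4)|}+c_5\Big)$ for some real constants $c,c_3,c_4,c_5$ with $c\ne0$ (with $\cos(cu-c_3)$ nonvanishing on $I$ and $\cos(cv-c_4)$ nonvanishing on $J$).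
   Context: $\mathbb{R}^3$ carries the Euclidean metric $\widetilde g$, with coordinate fields $X_1=\partial_x$, $X_2=\partial_y$, $X_3=\partial_z$ and Levi-Civita connection $\nabla^L$ (so $\nabla^L_{X_i}X_j=0$). The semi-symmetric non-metric connection $\overline\nabla$ is $$\overline\nabla_XY=\nabla^L_XY+\widetilde g(Y,X_3)X .$$ For an immersed surface $M$ parametrized by $\mathcal{F}(u,v)$, put $E_1=\mathcal{F}_u$, $E_2=\mathcal{F}_v$, let $N$ be a unit normal field, and let $E=\widetilde g(\mathcal{F}_u,\mathcal{F}_u)$, $F=\widetilde g(\mathcal{F}_u,\mathcal{F}_v)$, $G=\widetilde g(\mathcal{F}_v,\mathcal{F}_v)$. $M$ is minimal with respect to $\overline\nabla$ if its mean curvature with respect to $\overline\nabla$ (half the trace of $(X,Y)\mapsto\widetilde g(\overline\nabla_XY,N)$ on $TM$) vanishes everywhere, i.e. $$G\,\widetilde g(\overline\nabla_{E_1}E_1,N)-F\,\widetilde g(\overline\nabla_{E_1}E_2,N)-F\,\widetilde g(\overline\nabla_{E_2}E_1,N)+E\,\widetilde g(\overline\nabla_{E_2}E_2,N)=0 .$$ *)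

theory Defs
  imports "HOL-Analysis.Analysis"
begin

text \<open>The Euclidean metric on \<open>\<real>\<^sup>3\<close> is the library inner product on \<^typ>\<open>real ^ 3\<close>.\<close>

definition smooth_on :: "real set \<Rightarrow> (real \<Rightarrow> real) \<Rightarrow> bool" where
  "smooth_on S f \<longleftrightarrow> (\<forall>n. \<forall>x\<in>S. (deriv ^^ n) f differentiable (at x))"

definition X3 :: "real ^ 3" where
  "X3 = axis 3 1"

text \<open>The Levi-Civita connection of the Euclidean metric is the directional derivative of
  vector fields.\<close>

definition levi_civita ::
    "(real ^ 3 \<Rightarrow> real ^ 3) \<Rightarrow> (real ^ 3 \<Rightarrow> real ^ 3) \<Rightarrow> real ^ 3 \<Rightarrow> real ^ 3" where
  "levi_civita X Y p = frechet_derivative Y (at p) (X p)"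

definition nabla_bar ::
    "(real ^ 3 \<Rightarrow> real ^ 3) \<Rightarrow> (real ^ 3 \<Rightarrow> real ^ 3) \<Rightarrow> real ^ 3 \<Rightarrow> real ^ 3" where
  "nabla_bar X Y p = levi_civita X Y p + (Y p \<bullet> X3) *\<^sub>R X p"

definition partial_u :: "(real \<Rightarrow> real \<Rightarrow> real ^ 3) \<Rightarrow> real \<Rightarrow> real \<Rightarrow> real ^ 3" where
  "partial_u W u v = vector_derivative (\<lambda>s. W s v) (at u)"

definition partial_v :: "(real \<Rightarrow> real \<Rightarrow> real ^ 3) \<Rightarrow> real \<Rightarrow> real \<Rightarrow> real ^ 3" where
  "partial_v W u v = vector_derivative (\<lambda>t. W u t) (at v)"

text \<open>The fields \<open>E\<^sub>1 = partial_u F\<close> and \<open>E\<^sub>2 = partial_v F\<close> are only defined along the surface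
  \<open>F\<close>.  For a field \<open>W\<close> along \<open>F\<close>, and \<open>D\<close> one of \<^const>\<open>partial_u\<close>, \<^const>\<open>partial_v\<close>,
  \<open>nabla_bar_along D F W\<close> is the derivative of \<open>W\<close> in the direction \<open>D F\<close> for the connection
  along \<open>F\<close> induced by \<^const>\<open>nabla_bar\<close>; the two lemmas below state that it agrees with
  \<^const>\<open>nabla_bar\<close> on fields that are restrictions of ambient ones.\<close>

definition nabla_bar_along ::
    "((real \<Rightarrow> real \<Rightarrow> real ^ 3) \<Rightarrow> real \<Rightarrow> real \<Rightarrow> real ^ 3) \<Rightarrow>
     (real \<Rightarrow> real \<Rightarrow> real ^ 3) \<Rightarrow> (real \<Rightarrow> real \<Rightarrow> real ^ 3) \<Rightarrow> real \<Rightarrow> real \<Rightarrow> real ^ 3" where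
  "nabla_bar_along D F W u v = D W u v + (W u v \<bullet> X3) *\<^sub>R D F u v"

lemma vector_derivative_compose_frechet:
  fixes Y :: "real ^ 3 \<Rightarrow> real ^ 3" and c :: "real \<Rightarrow> real ^ 3"
  assumes "Y differentiable (at (c s))" and "c differentiable (at s)"
  shows "vector_derivative (\<lambda>s. Y (c s)) (at s) =
    frechet_derivative Y (at (c s)) (vector_derivative c (at s))"
proof -
  have Y: "(Y has_derivative frechet_derivative Y (at (c s))) (at (c s))"
    using assms(1) frechet_derivative_works by blast
  have c: "(c has_derivative (\<lambda>h. h *\<^sub>R vector_derivative c (at s))) (at s)"
    using assms(2) vector_derivative_works has_vector_derivative_def by blast
  have "linear (frechet_derivative Y (at (c s)))"
    using Y has_derivative_linear by blast
  then have "((\<lambda>s. Y (c s)) has_vector_derivative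
      frechet_derivative Y (at (c s)) (vector_derivative c (at s))) (at s)"
    using diff_chain_at[OF c Y]
    by (simp add: has_vector_derivative_def o_def linear_cmul)
  then show ?thesis
    by (rule vector_derivative_at)
qed

lemma nabla_bar_along_partial_u:
  assumes "Y differentiable (at (F u v))" and "(\<lambda>s. F s v) differentiable (at u)"
    and "X (F u v) = partial_u F u v"
  shows "nabla_bar_along partial_u F (\<lambda>u v. Y (F u v)) u v = nabla_bar X Y (F u v)"
  using vector_derivative_compose_frechet[of Y "\<lambda>s. F s v" u] assms
  by (simp add: nabla_bar_along_def nabla_bar_def levi_civita_def partial_u_def)

lemma nabla_bar_along_partial_v:
  assumes "Y differentiable (at (F u v))" and "(\<lambda>t. F u t) differentiable (at v)"
    and "X (F u v) = partial_v F u v"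
  shows "nabla_bar_along partial_v F (\<lambda>u v. Y (F u v)) u v = nabla_bar X Y (F u v)"
  using vector_derivative_compose_frechet[of Y "\<lambda>t. F u t" v] assms
  by (simp add: nabla_bar_along_def nabla_bar_def levi_civita_def partial_v_def)

definition unit_normal_on ::
    "(real \<times> real) set \<Rightarrow> (real \<Rightarrow> real \<Rightarrow> real ^ 3) \<Rightarrow> (real \<Rightarrow> real \<Rightarrow> real ^ 3) \<Rightarrow> bool" where
  "unit_normal_on U F N \<longleftrightarrow> (\<forall>(u, v)\<in>U.
     norm (N u v) = 1 \<and> N u v \<bullet> partial_u F u v = 0 \<and> N u v \<bullet> partial_v F u v = 0)"

text \<open>Half the trace of the (possibly non-symmetric) form \<open>(X, Y) \<mapsto> nabla_bar X Y \<bullet> N\<close> with respect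
  to the first fundamental form, written in the basis \<open>E1, E2\<close>.  The denominator is positive
  wherever \<open>F\<close> is an immersion.\<close>

definition mean_curvature ::
    "(real \<Rightarrow> real \<Rightarrow> real ^ 3) \<Rightarrow> (real \<Rightarrow> real \<Rightarrow> real ^ 3) \<Rightarrow> real \<Rightarrow> real \<Rightarrow> real" where
  "mean_curvature F N u v =
    (let E1 = partial_u F; E2 = partial_v F;
         E = E1 u v \<bullet> E1 u v; F' = E1 u v \<bullet> E2 u v; G = E2 u v \<bullet> E2 u v
     in (G * (nabla_bar_along partial_u F E1 u v \<bullet> N u v)
         - F' * (nabla_bar_along partial_u F E2 u v \<bullet> N u v)
         - F' * (nabla_bar_along partial_v F E1 u v \<bullet> N u v)
         + E * (nabla_bar_along partial_v F E2 u v \<bullet> N u v)) / (2 * (E * G - F'\<^sup>2)))"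

definition minimal_on ::
    "(real \<times> real) set \<Rightarrow> (real \<Rightarrow> real \<Rightarrow> real ^ 3) \<Rightarrow> (real \<Rightarrow> real \<Rightarrow> real ^ 3) \<Rightarrow> bool" where
  "minimal_on U F N \<longleftrightarrow> (\<forall>(u, v)\<in>U. mean_curvature F N u v = 0)"

definition translation_surface ::
    "(real \<Rightarrow> real) \<Rightarrow> (real \<Rightarrow> real) \<Rightarrow> real \<Rightarrow> real \<Rightarrow> real ^ 3" where
  "translation_surface f g u v = vector [u, v, f u + g v]"

end

theory Submission
  imports Defs
begin

text \<open>The non-metric term \<open>(W \<bullet> X3) *\<^sub>R D F\<close> of the connection is tangent to the surface, so the normal
  kills it and minimality with respect to \<open>\<nabla>\<close>-bar is ordinary Euclidean minimality.  The third
  component of a normal to a graph never vanishes, and minimality therefore amounts to the equation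
  \<open>(1 + g'\<^sup>2) f'' + (1 + f'\<^sup>2) g'' = 0\<close> (\<open>minimal_on_translation_surface_iff\<close>).

  This equation separates: \<open>f'' / (1 + f'\<^sup>2)\<close> depends on \<open>u\<close> alone and equals
  \<open>- g'' / (1 + g'\<^sup>2)\<close>, which depends on \<open>v\<close> alone, so both equal a constant \<open>- c\<close>
  (\<open>separation_of_variables\<close>).  What remains is a pair of ordinary differential equations of the same
  kind, \<open>f'' = - c (1 + f'\<^sup>2)\<close>, saying that \<open>arctan f'\<close> has constant slope \<open>- c\<close>.  For \<open>c = 0\<close> the
  solutions are affine; for \<open>c \<noteq> 0\<close> they are \<open>ln \<bar>cos (c u - a)\<bar> / c + m\<close>
  (\<open>zero_second_deriv_iff_affine\<close>, \<open>constant_angular_slope_iff_log_cos\<close>).  The equation for \<open>g\<close> is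
  the one for \<open>f\<close> with \<open>- c\<close> in place of \<open>c\<close>, whence the quotient of cosines.

  In both families the height is a sum of a function of \<open>u\<close> and a function of \<open>v\<close>.  Such a sum
  determines its summands up to a constant exchanged between them (\<open>sum_of_profiles_iff\<close>), which
  turns a formula for \<open>f u + g v\<close> into formulas for \<open>f\<close> and \<open>g\<close>.\<close>

section \<open>Minimality as a differential equation\<close>

lemma vector_3_eq_axes:
  "(vector [a, b, c] :: real ^ 3) = a *\<^sub>R axis 1 1 + b *\<^sub>R axis 2 1 + c *\<^sub>R axis 3 1"
  by (simp add: vec_eq_iff forall_3 axis_def)

lemma has_vector_derivative_vector_3:
  assumes "(a has_real_derivative a') (at s)" "(b has_real_derivative b') (at s)"
    "(c has_real_derivative c') (at s)"
  shows "((\<lambda>s. vector [a s, b s, c s] :: real ^ 3) has_vector_derivative vector [a', b', c']) (at s)"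
  unfolding vector_3_eq_axes
  by (intro has_vector_derivative_add)
    (use has_vector_derivative_scaleR[OF _ has_vector_derivative_const] assms in fastforce)+

lemma smooth_on_imp_derivatives:
  assumes "smooth_on S f" and "x \<in> S"
  shows "(f has_real_derivative deriv f x) (at x)"
    and "(deriv f has_real_derivative deriv (deriv f) x) (at x)"
proof -
  have "(deriv ^^ 0) f differentiable (at x)" "(deriv ^^ 1) f differentiable (at x)"
    using assms unfolding smooth_on_def by blast+
  then show "(f has_real_derivative deriv f x) (at x)"
    and "(deriv f has_real_derivative deriv (deriv f) x) (at x)"
    by (simp_all add: DERIV_deriv_iff_real_differentiable)
qed

lemma partial_u_translation_surface:
  assumes "f differentiable (at u)"
  shows "partial_u (translation_surface f g) u v = vector [1, 0, deriv f u]"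
proof -
  have "((\<lambda>s. f s + g v) has_real_derivative deriv f u) (at u)"
    using assms DERIV_deriv_iff_real_differentiable by (auto intro!: derivative_eq_intros)
  then show ?thesis
    unfolding partial_u_def translation_surface_def
    by (intro vector_derivative_at has_vector_derivative_vector_3 DERIV_ident DERIV_const)
qed

lemma partial_v_translation_surface:
  assumes "g differentiable (at v)"
  shows "partial_v (translation_surface f g) u v = vector [0, 1, deriv g v]"
proof -
  have "((\<lambda>t. f u + g t) has_real_derivative deriv g v) (at v)"
    using assms DERIV_deriv_iff_real_differentiable by (auto intro!: derivative_eq_intros)
  then show ?thesis
    unfolding partial_v_def translation_surface_def
    by (intro vector_derivative_at has_vector_derivative_vector_3 DERIV_ident DERIV_const)
qed

lemma second_partials_translation_surface:
  assumes I: "open I" "smooth_on I f" "u \<in> I" and J: "open J" "smooth_on J g" "v \<in> J"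
  defines "F \<equiv> translation_surface f g"
  shows "partial_u (partial_u F) u v = vector [0, 0, deriv (deriv f) u]"
    and "partial_u (partial_v F) u v = 0"
    and "partial_v (partial_u F) u v = 0"
    and "partial_v (partial_v F) u v = vector [0, 0, deriv (deriv g) v]"
proof -
  have f1: "f differentiable (at s)" if "s \<in> I" for s
    using smooth_on_imp_derivatives(1)[OF I(2) that] real_differentiable_def by blast
  have g1: "g differentiable (at t)" if "t \<in> J" for t
    using smooth_on_imp_derivatives(1)[OF J(2) that] real_differentiable_def by blast
  have "((\<lambda>s. vector [1, 0, deriv f s] :: real ^ 3) has_vector_derivative
      vector [0, 0, deriv (deriv f) u]) (at u)"
    using smooth_on_imp_derivatives(2)[OF I(2,3)]
    by (intro has_vector_derivative_vector_3 DERIV_const)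
  then have "((\<lambda>s. partial_u F s v) has_vector_derivative vector [0, 0, deriv (deriv f) u]) (at u)"
    by (rule has_vector_derivative_transform_within_open[OF _ I(1,3)])
      (simp add: F_def f1 partial_u_translation_surface)
  then show "partial_u (partial_u F) u v = vector [0, 0, deriv (deriv f) u]"
    by (simp add: partial_u_def[of "partial_u F"] vector_derivative_at)
  have "((\<lambda>t. vector [0, 1, deriv g t] :: real ^ 3) has_vector_derivative
      vector [0, 0, deriv (deriv g) v]) (at v)"
    using smooth_on_imp_derivatives(2)[OF J(2,3)]
    by (intro has_vector_derivative_vector_3 DERIV_const)
  then have "((\<lambda>t. partial_v F u t) has_vector_derivative vector [0, 0, deriv (deriv g) v]) (at v)"
    by (rule has_vector_derivative_transform_within_open[OF _ J(1,3)])
      (simp add: F_def g1 partial_v_translation_surface)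
  then show "partial_v (partial_v F) u v = vector [0, 0, deriv (deriv g) v]"
    by (simp add: partial_v_def[of "partial_v F"] vector_derivative_at)
  show "partial_u (partial_v F) u v = 0"
    unfolding partial_u_def[of "partial_v F"]
    using g1[OF J(3)] by (simp add: F_def partial_v_translation_surface)
  have "partial_u F u = (\<lambda>t. vector [1, 0, deriv f u])"
    using f1[OF I(3)] by (simp add: F_def fun_eq_iff partial_u_translation_surface)
  then show "partial_v (partial_u F) u v = 0"
    by (simp add: partial_v_def[of "partial_u F"])
qed

text \<open>The mixed second partials vanish because the height is a sum, leaving the two pure
  second derivatives, weighted by \<open>1 + g'\<^sup>2\<close> and \<open>1 + f'\<^sup>2\<close>.\<close>

lemma mean_curvature_translation_surface:
  assumes I: "open I" "smooth_on I f" "u \<in> I" and J: "open J" "smooth_on J g" "v \<in> J"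
    and N: "unit_normal_on (I \<times> J) (translation_surface f g) N"
  shows "mean_curvature (translation_surface f g) N u v =
    N u v $ 3 * ((1 + (deriv g v)\<^sup>2) * deriv (deriv f) u + (1 + (deriv f u)\<^sup>2) * deriv (deriv g) v) /
    (2 * (1 + (deriv f u)\<^sup>2 + (deriv g v)\<^sup>2))"
proof -
  define F where "F = translation_surface f g"
  have Fu: "partial_u F u v = vector [1, 0, deriv f u]"
    using smooth_on_imp_derivatives(1)[OF I(2,3)] real_differentiable_def
    unfolding F_def by (blast intro: partial_u_translation_surface)
  have Fv: "partial_v F u v = vector [0, 1, deriv g v]"
    using smooth_on_imp_derivatives(1)[OF J(2,3)] real_differentiable_def
    unfolding F_def by (blast intro: partial_v_translation_surface)
  note second = second_partials_translation_surface[OF I J, folded F_def]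
  have tangent: "partial_u F u v \<bullet> N u v = 0" "partial_v F u v \<bullet> N u v = 0"
    using N I(3) J(3) unfolding unit_normal_on_def F_def by (auto simp: inner_commute)
  \<comment> \<open>Only the ordinary second derivatives survive the pairing with the normal.\<close>
  have conn: "nabla_bar_along partial_u F W u v \<bullet> N u v = partial_u W u v \<bullet> N u v"
    "nabla_bar_along partial_v F W u v \<bullet> N u v = partial_v W u v \<bullet> N u v" for W
    by (simp_all add: nabla_bar_along_def inner_add_left tangent)
  have coeffs: "partial_u F u v \<bullet> partial_u F u v = 1 + (deriv f u)\<^sup>2"
    "partial_u F u v \<bullet> partial_v F u v = deriv f u * deriv g v"
    "partial_v F u v \<bullet> partial_v F u v = 1 + (deriv g v)\<^sup>2"
    by (simp_all add: Fu Fv inner_vec_def sum_3 power2_eq_square)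
  have normal: "(vector [0, 0, a] :: real ^ 3) \<bullet> N u v = a * N u v $ 3" for a
    by (simp add: inner_vec_def sum_3)
  have det: "(1 + (deriv f u)\<^sup>2) * (1 + (deriv g v)\<^sup>2) - (deriv f u * deriv g v)\<^sup>2
      = 1 + (deriv f u)\<^sup>2 + (deriv g v)\<^sup>2"
    by (simp add: algebra_simps power_mult_distrib)
  show ?thesis
    unfolding F_def[symmetric] mean_curvature_def Let_def conn coeffs det second normal
    by (simp add: algebra_simps)
qed

text \<open>If the third component vanished, orthogonality to the tangent vectors \<open>(1, 0, f')\<close> and
  \<open>(0, 1, g')\<close> would make the other two vanish as well.\<close>

lemma unit_normal_third_component_nonzero:
  assumes "unit_normal_on U (translation_surface f g) N" and "(u, v) \<in> U"
    and "f differentiable (at u)" and "g differentiable (at v)"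
  shows "N u v $ 3 \<noteq> 0"
proof
  assume 0: "N u v $ 3 = 0"
  have "norm (N u v) = 1" "N u v \<bullet> partial_u (translation_surface f g) u v = 0"
    "N u v \<bullet> partial_v (translation_surface f g) u v = 0"
    using assms(1,2) unfolding unit_normal_on_def by auto
  then have "N u v $ 1 = 0" "N u v $ 2 = 0"
    using 0 assms(3,4)
    by (simp_all add: partial_u_translation_surface partial_v_translation_surface inner_vec_def sum_3)
  then have "N u v = 0"
    using 0 by (simp add: vec_eq_iff forall_3)
  then show False
    using \<open>norm (N u v) = 1\<close> by simp
qed

lemma minimal_on_translation_surface_iff:
  assumes I: "open I" "smooth_on I f" and J: "open J" "smooth_on J g"
    and N: "unit_normal_on (I \<times> J) (translation_surface f g) N"
  shows "minimal_on (I \<times> J) (translation_surface f g) N \<longleftrightarrow>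
    (\<forall>u\<in>I. \<forall>v\<in>J. (1 + (deriv g v)\<^sup>2) * deriv (deriv f) u
                 + (1 + (deriv f u)\<^sup>2) * deriv (deriv g) v = 0)"
proof -
  have "mean_curvature (translation_surface f g) N u v = 0 \<longleftrightarrow>
      (1 + (deriv g v)\<^sup>2) * deriv (deriv f) u + (1 + (deriv f u)\<^sup>2) * deriv (deriv g) v = 0"
    if u: "u \<in> I" and v: "v \<in> J" for u v
  proof -
    have "f differentiable (at u)" "g differentiable (at v)"
      using smooth_on_imp_derivatives(1)[OF I(2) u] smooth_on_imp_derivatives(1)[OF J(2) v]
        real_differentiable_def by blast+
    then have "N u v $ 3 \<noteq> 0"
      using unit_normal_third_component_nonzero[OF N] u v by blast
    moreover have "1 + (deriv f u)\<^sup>2 + (deriv g v)\<^sup>2 \<noteq> 0"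
      by (simp add: add_nonneg_eq_0_iff)
    ultimately show ?thesis
      by (simp add: mean_curvature_translation_surface[OF I u J v N])
  qed
  then show ?thesis
    unfolding minimal_on_def by auto
qed

section \<open>Separation of variables\<close>

lemma separation_of_variables:
  fixes a p :: "'a \<Rightarrow> real" and b q :: "'b \<Rightarrow> real"
  assumes "I \<noteq> {}" and "J \<noteq> {}"
  shows "(\<forall>u\<in>I. \<forall>v\<in>J. (1 + (q v)\<^sup>2) * a u + (1 + (p u)\<^sup>2) * b v = 0) \<longleftrightarrow>
    (\<exists>c. (\<forall>u\<in>I. a u = - c * (1 + (p u)\<^sup>2)) \<and> (\<forall>v\<in>J. b v = c * (1 + (q v)\<^sup>2)))"
    (is "?L \<longleftrightarrow> ?R")
proof
  assume L: ?L
  have pos: "1 + x\<^sup>2 \<noteq> 0" for x :: real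
    by (simp add: add_nonneg_eq_0_iff)
  obtain u0 v0 where 0: "u0 \<in> I" "v0 \<in> J"
    using assms by blast
  define c where "c = b v0 / (1 + (q v0)\<^sup>2)"
  have a: "a u = - c * (1 + (p u)\<^sup>2)" if "u \<in> I" for u
  proof -
    have "(1 + (q v0)\<^sup>2) * a u = - (b v0 * (1 + (p u)\<^sup>2))"
      using L that 0 by (simp add: eq_neg_iff_add_eq_0 mult.commute)
    then show ?thesis
      using pos[of "q v0"] by (simp add: c_def divide_simps mult.commute)
  qed
  have "b v = c * (1 + (q v)\<^sup>2)" if "v \<in> J" for v
  proof -
    have "(1 + (q v)\<^sup>2) * (- c * (1 + (p u0)\<^sup>2)) + (1 + (p u0)\<^sup>2) * b v = 0"
      using L that 0 a[of u0] by metis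
    then have "(1 + (p u0)\<^sup>2) * (b v - c * (1 + (q v)\<^sup>2)) = 0"
      by (simp add: algebra_simps)
    then show ?thesis
      using pos[of "p u0"] by simp
  qed
  with a show ?R
    by blast
next
  assume ?R
  then show ?L
    by auto
qed

lemma sum_of_profiles_iff:
  fixes f \<phi> :: "'a \<Rightarrow> real" and g \<psi> :: "'b \<Rightarrow> real"
  assumes "I \<noteq> {}" and "J \<noteq> {}"
  shows "(\<exists>k. \<forall>u\<in>I. \<forall>v\<in>J. f u + g v = \<phi> u + \<psi> v + k) \<longleftrightarrow>
    (\<exists>m. \<forall>u\<in>I. f u = \<phi> u + m) \<and> (\<exists>m. \<forall>v\<in>J. g v = \<psi> v + m)" (is "?L \<longleftrightarrow> ?R")
proof
  assume ?L
  then obtain k where k: "f u + g v = \<phi> u + \<psi> v + k" if "u \<in> I" "v \<in> J" for u v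
    by blast
  obtain u0 v0 where 0: "u0 \<in> I" "v0 \<in> J"
    using assms by blast
  have "f u = \<phi> u + (\<psi> v0 + k - g v0)" if "u \<in> I" for u
    using k[OF that 0(2)] by simp
  moreover have "g v = \<psi> v + (\<phi> u0 + k - f u0)" if "v \<in> J" for v
    using k[OF 0(1) that] by simp
  ultimately show ?R
    by blast
next
  assume ?R
  then obtain m n where "\<forall>u\<in>I. f u = \<phi> u + m" "\<forall>v\<in>J. g v = \<psi> v + n"
    by blast
  then have "\<forall>u\<in>I. \<forall>v\<in>J. f u + g v = \<phi> u + \<psi> v + (m + n)"
    by simp
  then show ?L
    by blast
qed

section \<open>The profile equation\<close>

lemma equal_derivatives_imp_differ_by_constant:
  fixes f \<phi> d :: "real \<Rightarrow> real"
  assumes "convex S"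
    and "\<And>x. x \<in> S \<Longrightarrow> (f has_real_derivative d x) (at x)"
    and "\<And>x. x \<in> S \<Longrightarrow> (\<phi> has_real_derivative d x) (at x)"
  shows "\<exists>m. \<forall>x\<in>S. f x = \<phi> x + m"
proof -
  have "((\<lambda>x. f x - \<phi> x) has_real_derivative 0) (at x within S)" if "x \<in> S" for x
    using DERIV_diff[OF assms(2,3)[OF that]] by (simp add: has_field_derivative_at_within)
  then obtain m where "\<forall>x\<in>S. f x - \<phi> x = m"
    using has_field_derivative_zero_constant[OF assms(1)] by blast
  then show ?thesis
    by (auto intro!: exI[of _ m] simp: diff_eq_eq add.commute)
qed

lemma derivs_eq_of_eq_on_open:
  fixes f \<phi> :: "real \<Rightarrow> real"
  assumes "open S" and "x \<in> S" and eq: "\<And>y. y \<in> S \<Longrightarrow> f y = \<phi> y"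
    and d1: "\<And>y. y \<in> S \<Longrightarrow> (\<phi> has_real_derivative \<phi>' y) (at y)"
    and d2: "(\<phi>' has_real_derivative d) (at x)"
  shows "deriv f x = \<phi>' x" and "deriv (deriv f) x = d"
proof -
  have f1: "deriv f y = \<phi>' y" if "y \<in> S" for y
    by (rule DERIV_imp_deriv, rule has_field_derivative_transform_within_open[OF d1[OF that] assms(1) that])
      (simp add: eq)
  show "deriv f x = \<phi>' x"
    by (rule f1[OF assms(2)])
  show "deriv (deriv f) x = d"
    by (rule DERIV_imp_deriv, rule has_field_derivative_transform_within_open[OF d2 assms(1,2)])
      (simp add: f1)
qed

lemma zero_second_deriv_iff_affine:
  assumes "open S" and "convex S" and "smooth_on S f"
  shows "(\<forall>x\<in>S. deriv (deriv f) x = 0) \<longleftrightarrow> (\<exists>p m. \<forall>x\<in>S. f x = p * x + m)" (is "?L \<longleftrightarrow> ?R")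
proof
  assume L: ?L
  have "\<exists>p. \<forall>x\<in>S. deriv f x = 0 + p"
    by (rule equal_derivatives_imp_differ_by_constant[OF assms(2), where d = "\<lambda>_. 0"])
      (use smooth_on_imp_derivatives(2)[OF assms(3)] L in auto)
  then obtain p where p: "\<And>x. x \<in> S \<Longrightarrow> deriv f x = p"
    by auto
  have "\<exists>m. \<forall>x\<in>S. f x = p * x + m"
    by (rule equal_derivatives_imp_differ_by_constant[OF assms(2), where d = "\<lambda>_. p"])
      (use smooth_on_imp_derivatives(1)[OF assms(3)] p in \<open>auto intro!: derivative_eq_intros\<close>)
  then show ?R
    by blast
next
  assume ?R
  then obtain p m where pm: "\<And>x. x \<in> S \<Longrightarrow> f x = p * x + m"
    by blast
  have "deriv (deriv f) x = 0" if "x \<in> S" for x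
    by (rule derivs_eq_of_eq_on_open(2)[OF assms(1) that pm, where \<phi>' = "\<lambda>_. p"])
      (auto intro!: derivative_eq_intros)
  then show ?L
    by blast
qed

lemma has_derivative_ln_abs_cos:
  fixes c a :: real
  assumes "c \<noteq> 0" and "cos (c * x - a) \<noteq> 0"
  shows "((\<lambda>x. ln \<bar>cos (c * x - a)\<bar> / c) has_real_derivative - tan (c * x - a)) (at x)"
proof -
  have "0 < cos (c * x - a) * cos (c * x - a)"
    using assms(2) by (simp flip: power2_eq_square)
  \<comment> \<open>Squaring removes the absolute value without a case distinction on the sign of the cosine.\<close>
  have "ln \<bar>cos y\<bar> = ln ((cos y)\<^sup>2) / 2" for y :: real
    using ln_realpow[of "\<bar>cos y\<bar>" 2] by (cases "cos y = 0") simp_all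
  then have "(\<lambda>x. ln \<bar>cos (c * x - a)\<bar> / c) = (\<lambda>x. ln ((cos (c * x - a))\<^sup>2) / (2 * c))"
    by (metis divide_divide_eq_left)
  moreover have "((\<lambda>x. ln ((cos (c * x - a))\<^sup>2) / (2 * c)) has_real_derivative
      - tan (c * x - a)) (at x)"
    using assms \<open>0 < cos (c * x - a) * cos (c * x - a)\<close>
    by (auto intro!: derivative_eq_intros simp: tan_def field_simps power2_eq_square)
  ultimately show ?thesis
    by simp
qed

text \<open>The equation says that the angle \<open>arctan h\<close> has constant derivative \<open>- c\<close>.  Since an
  arctangent stays within \<open>(- \<pi>/2, \<pi>/2)\<close>, the cosine of the resulting affine function cannot
  vanish: the interval is confined to a single branch of the tangent.\<close>

lemma riccati_solution_tan:
  fixes h :: "real \<Rightarrow> real"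
  assumes "convex S"
    and "\<And>x. x \<in> S \<Longrightarrow> (h has_real_derivative - c * (1 + (h x)\<^sup>2)) (at x)"
  obtains a where "\<And>x. x \<in> S \<Longrightarrow> cos (c * x - a) \<noteq> 0"
    and "\<And>x. x \<in> S \<Longrightarrow> h x = - tan (c * x - a)"
proof -
  have "((\<lambda>x. arctan (h x)) has_real_derivative - c) (at x)" if "x \<in> S" for x
  proof -
    have "1 + (h x)\<^sup>2 \<noteq> 0"
      by (simp add: add_nonneg_eq_0_iff)
    then have "inverse (1 + (h x)\<^sup>2) * (- c * (1 + (h x)\<^sup>2)) = - c"
      by simp
    then show ?thesis
      using DERIV_chain2[OF DERIV_arctan assms(2)[OF that]] by metis
  qed
  moreover have "((\<lambda>x. - c * x) has_real_derivative - c) (at x)" for x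
    by (auto intro!: derivative_eq_intros)
  ultimately have "\<exists>a. \<forall>x\<in>S. arctan (h x) = - c * x + a"
    by (intro equal_derivatives_imp_differ_by_constant[OF assms(1), where d = "\<lambda>_. - c"])
  then obtain a where a: "\<And>x. x \<in> S \<Longrightarrow> c * x - a = - arctan (h x)"
    by force
  show thesis
  proof (rule that)
    show "cos (c * x - a) \<noteq> 0" "h x = - tan (c * x - a)" if "x \<in> S" for x
      by (simp_all add: a[OF that] cos_arctan_not_zero tan_arctan)
  qed
qed

lemma constant_angular_slope_iff_log_cos:
  assumes "open S" and "convex S" and "smooth_on S f" and "c \<noteq> 0"
  shows "(\<forall>x\<in>S. deriv (deriv f) x = - c * (1 + (deriv f x)\<^sup>2)) \<longleftrightarrow>
    (\<exists>a. (\<forall>x\<in>S. cos (c * x - a) \<noteq> 0) \<and>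
         (\<exists>m. \<forall>x\<in>S. f x = ln \<bar>cos (c * x - a)\<bar> / c + m))" (is "?L \<longleftrightarrow> ?R")
proof
  assume L: ?L
  obtain a where a: "\<And>x. x \<in> S \<Longrightarrow> cos (c * x - a) \<noteq> 0"
    "\<And>x. x \<in> S \<Longrightarrow> deriv f x = - tan (c * x - a)"
    by (rule riccati_solution_tan[OF assms(2), of "deriv f" c])
      (use smooth_on_imp_derivatives(2)[OF assms(3)] L in auto)
  have "\<exists>m. \<forall>x\<in>S. f x = ln \<bar>cos (c * x - a)\<bar> / c + m"
    using smooth_on_imp_derivatives(1)[OF assms(3)] a has_derivative_ln_abs_cos[OF assms(4)]
    by (intro equal_derivatives_imp_differ_by_constant[OF assms(2), where d = "\<lambda>x. - tan (c * x - a)"])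
      auto
  with a(1) show ?R
    by blast
next
  assume ?R
  then obtain a m where a: "\<And>x. x \<in> S \<Longrightarrow> cos (c * x - a) \<noteq> 0"
    and m: "\<And>x. x \<in> S \<Longrightarrow> f x = ln \<bar>cos (c * x - a)\<bar> / c + m"
    by blast
  have "deriv (deriv f) x = - c * (1 + (deriv f x)\<^sup>2)" if "x \<in> S" for x
  proof -
    have d1: "((\<lambda>x. ln \<bar>cos (c * x - a)\<bar> / c + m) has_real_derivative - tan (c * y - a)) (at y)"
      if "y \<in> S" for y
      using DERIV_add[OF has_derivative_ln_abs_cos[OF assms(4) a[OF that]] DERIV_const] by simp
    have d2: "((\<lambda>x. - tan (c * x - a)) has_real_derivative - c * (1 + (tan (c * x - a))\<^sup>2)) (at x)"
      using a[OF that]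
      by (auto intro!: derivative_eq_intros simp: tan_sec inverse_eq_divide power_divide)
    show ?thesis
      using derivs_eq_of_eq_on_open[OF assms(1) that m d1 d2] by simp
  qed
  then show ?L
    by blast
qed

section \<open>Classification\<close>

theorem theorem2p4:
  fixes I J :: "real set" and f g :: "real \<Rightarrow> real" and N :: "real \<Rightarrow> real \<Rightarrow> real ^ 3"
  assumes "open I" and "is_interval I" and "I \<noteq> {}"
    and "open J" and "is_interval J" and "J \<noteq> {}"
    and "smooth_on I f" and "smooth_on J g"
    and "unit_normal_on (I \<times> J) (translation_surface f g) N"
  shows "minimal_on (I \<times> J) (translation_surface f g) N \<longleftrightarrow>
    (\<exists>c0 c1 c2. \<forall>u\<in>I. \<forall>v\<in>J.
        translation_surface f g u v = vector [u, v, c0 * u + c1 * v + c2]) \<or>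
    (\<exists>c c3 c4 c5. c \<noteq> 0 \<and>
        (\<forall>u\<in>I. cos (c * u - c3) \<noteq> 0) \<and> (\<forall>v\<in>J. cos (c * v - c4) \<noteq> 0) \<and>
        (\<forall>u\<in>I. \<forall>v\<in>J. translation_surface f g u v =
           vector [u, v, 1 / c * ln (\<bar>cos (c * u - c3)\<bar> / \<bar>cos (c * v - c4)\<bar>) + c5]))"
proof -
  have conv: "convex I" "convex J"
    using assms(2,5) by (simp_all add: is_interval_convex)
  have surface: "translation_surface f g u v = vector [u, v, z] \<longleftrightarrow> f u + g v = z" for u v z
    by (auto simp: translation_surface_def vec_eq_iff forall_3)
  define P where "P c \<longleftrightarrow> (\<forall>u\<in>I. deriv (deriv f) u = - c * (1 + (deriv f u)\<^sup>2)) \<and>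
    (\<forall>v\<in>J. deriv (deriv g) v = c * (1 + (deriv g v)\<^sup>2))" for c
  have "minimal_on (I \<times> J) (translation_surface f g) N \<longleftrightarrow> (\<exists>c. P c)"
    unfolding P_def minimal_on_translation_surface_iff[OF assms(1,7,4,8,9)]
    by (rule separation_of_variables[OF assms(3,6)])
  also have "\<dots> \<longleftrightarrow> P 0 \<or> (\<exists>c. c \<noteq> 0 \<and> P c)"
    by metis
  also have "P 0 \<longleftrightarrow> (\<exists>c0 c1 c2. \<forall>u\<in>I. \<forall>v\<in>J. f u + g v = c0 * u + c1 * v + c2)"
    using zero_second_deriv_iff_affine[OF assms(1) conv(1) assms(7)]
      zero_second_deriv_iff_affine[OF assms(4) conv(2) assms(8)]
    unfolding P_def sum_of_profiles_iff[OF assms(3,6)] by simp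
  also have "(\<exists>c. c \<noteq> 0 \<and> P c) \<longleftrightarrow> (\<exists>c c3 c4 c5. c \<noteq> 0 \<and>
      (\<forall>u\<in>I. cos (c * u - c3) \<noteq> 0) \<and> (\<forall>v\<in>J. cos (c * v - c4) \<noteq> 0) \<and>
      (\<forall>u\<in>I. \<forall>v\<in>J. f u + g v = 1 / c * ln (\<bar>cos (c * u - c3)\<bar> / \<bar>cos (c * v - c4)\<bar>) + c5))"
    (is "_ \<longleftrightarrow> (\<exists>c c3 c4 c5. c \<noteq> 0 \<and> ?cf c c3 \<and> ?cg c c4 \<and> ?E c c3 c4 c5)")
  proof -
    have "P c \<longleftrightarrow> (\<exists>c3 c4 c5. ?cf c c3 \<and> ?cg c c4 \<and> ?E c c3 c4 c5)" if c: "c \<noteq> 0" for c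
    proof -
      \<comment> \<open>\<open>g\<close> solves the profile equation with constant \<open>- c\<close>; evenness of the cosine rewrites its
        solutions with frequency \<open>c\<close>, at the price of negating the phase.\<close>
      have even: "cos (- c * v - a) = cos (c * v - (- a))" for v a
      proof -
        have "- c * v - a = - (c * v - (- a))"
          by simp
        then show ?thesis
          by (simp only: cos_minus)
      qed
      have g: "(\<forall>v\<in>J. deriv (deriv g) v = c * (1 + (deriv g v)\<^sup>2)) \<longleftrightarrow>
          (\<exists>c4. ?cg c c4 \<and> (\<exists>m. \<forall>v\<in>J. g v = - (ln \<bar>cos (c * v - c4)\<bar> / c) + m))"
        (is "_ \<longleftrightarrow> (\<exists>c4. ?Q c4)")
      proof -
        have "(\<forall>v\<in>J. deriv (deriv g) v = c * (1 + (deriv g v)\<^sup>2)) \<longleftrightarrow> (\<exists>a. ?Q (- a))"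
          using constant_angular_slope_iff_log_cos[OF assms(4) conv(2) assms(8), of "- c"] c
          unfolding even by simp
        also have "\<dots> \<longleftrightarrow> (\<exists>c4. ?Q c4)"
          by (metis minus_minus)
        finally show ?thesis .
      qed
      have split: "(\<exists>c5. ?E c c3 c4 c5) \<longleftrightarrow>
          (\<exists>m. \<forall>u\<in>I. f u = ln \<bar>cos (c * u - c3)\<bar> / c + m) \<and>
          (\<exists>m. \<forall>v\<in>J. g v = - (ln \<bar>cos (c * v - c4)\<bar> / c) + m)"
        if "?cf c c3" "?cg c c4" for c3 c4
      proof -
        have "1 / c * ln (\<bar>cos (c * u - c3)\<bar> / \<bar>cos (c * v - c4)\<bar>) =
            ln \<bar>cos (c * u - c3)\<bar> / c + - (ln \<bar>cos (c * v - c4)\<bar> / c)"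
          if "u \<in> I" "v \<in> J" for u v
          using \<open>?cf c c3\<close> \<open>?cg c c4\<close> that by (simp add: ln_div diff_divide_distrib)
        then have "(\<exists>c5. ?E c c3 c4 c5) \<longleftrightarrow> (\<exists>c5. \<forall>u\<in>I. \<forall>v\<in>J. f u + g v =
            ln \<bar>cos (c * u - c3)\<bar> / c + - (ln \<bar>cos (c * v - c4)\<bar> / c) + c5)"
          by simp
        then show ?thesis
          unfolding sum_of_profiles_iff[OF assms(3,6)] .
      qed
      have "P c \<longleftrightarrow> (\<exists>c3. ?cf c c3 \<and> (\<exists>m. \<forall>u\<in>I. f u = ln \<bar>cos (c * u - c3)\<bar> / c + m)) \<and>
          (\<exists>c4. ?cg c c4 \<and> (\<exists>m. \<forall>v\<in>J. g v = - (ln \<bar>cos (c * v - c4)\<bar> / c) + m))"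
        unfolding P_def g constant_angular_slope_iff_log_cos[OF assms(1) conv(1) assms(7) c] ..
      also have "\<dots> \<longleftrightarrow> (\<exists>c3 c4. ?cf c c3 \<and> ?cg c c4 \<and> (\<exists>c5. ?E c c3 c4 c5))"
        using split by blast
      also have "\<dots> \<longleftrightarrow> (\<exists>c3 c4 c5. ?cf c c3 \<and> ?cg c c4 \<and> ?E c c3 c4 c5)"
        by blast
      finally show ?thesis .
    qed
    then show ?thesis
      by blast
  qed
  finally show ?thesis
    unfolding surface .
qed

end
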